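(* For every $n\ge 1$, the underlying graph $J_n^*(1)$ of the finite Jaco graph $J_n(1)$ satisfies $1\le cn(J_n^*(1))\le 3$.
   Context: The Jaco graph of order $1$, $J_\infty(1)$, is the directed graph with vertex set $\{v_i: i\in\mathbb{N}\}$ ($\mathbb{N}=\{1,2,\dots\}$) and arc set contained in $\{(v_i,v_j): i,j\in\mathbb{N},\ i<j\}$, where, for $i<j$, $(v_i,v_j)$ is an arc if and only if $2i-d^-(v_i)\ge j$; here $d^-(v_i)$ is the in-degree of $v_i$. The finite Jaco graph $J_n(1)$ is obtained from $J_\infty(1)$ by deleting all vertices $v_t$ with $t>n$ (and their arcs), and $J_n^*(1)$ is its underlying undirected graph. For a finite non-empty string $S$ of non-negative integers, $cn(S)$ is the largest $k$ such that $S=X\circ Y^k$, with $\circ$ concatenation, $X$ a possibly empty prefix and $Y$ a non-empty string. The curling number $cn(G)$ of a graph $G$ is the maximum of $cn(S_0)$ over all re-arrangements $S_0$ of its degree sequence. *)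

theory Defs
  imports "Graph_Theory.Graph_Theory" "HOL-Combinatorics.Multiset_Permutations"
begin

context
  notes conj_cong [fundef_cong] Collect_cong [fundef_cong]
begin

text \<open>
  The vertex \<open>v\<^sub>i\<close> is the natural number \<open>i \<ge> 1\<close>. The arc condition refers to the in-degree of
  the tail \<open>i\<close>, which only involves arcs \<open>(h, i)\<close> with \<open>h < i\<close>; hence the recursion. That this is
  the in-degree in the resulting graph is the content of \<open>arc_Jaco_inf_iff\<close> below.
\<close>
function jaco_arc :: "nat \<Rightarrow> nat \<Rightarrow> bool" where
  "jaco_arc i j \<longleftrightarrow> 1 \<le> i \<and> i < j \<and>
     2 * int i - int (card {h. h < i \<and> jaco_arc h i}) \<ge> int j"
  by auto
termination by (relation "measure fst") auto

end

declare jaco_arc.simps [simp del]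

definition Jaco_inf :: "nat pair_pre_digraph" where
  "Jaco_inf = \<lparr>pverts = {i. 1 \<le> i}, parcs = {(i, j). jaco_arc i j}\<rparr>"

definition Jaco :: "nat \<Rightarrow> (nat, nat \<times> nat) pre_digraph" where
  "Jaco n = with_proj Jaco_inf \<restriction> {1..n}"

text \<open>An undirected graph is represented by its symmetric digraph.\<close>
definition Jaco_star :: "nat \<Rightarrow> nat pair_pre_digraph" where
  "Jaco_star n = mk_symmetric (Jaco n)"

lemma arc_Jaco_inf_iff:
  "(i, j) \<in> arcs (with_proj Jaco_inf) \<longleftrightarrow>
     1 \<le> i \<and> i < j \<and> 2 * int i - int (in_degree (with_proj Jaco_inf) i) \<ge> int j"
proof -
  have less: "jaco_arc h i \<Longrightarrow> h < i" for h i
    by (subst (asm) jaco_arc.simps) simp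
  have "in_arcs (with_proj Jaco_inf) i = (\<lambda>h. (h, i)) ` {h. h < i \<and> jaco_arc h i}"
    using less by (auto simp: in_arcs_def Jaco_inf_def)
  then have "in_degree (with_proj Jaco_inf) i = card {h. h < i \<and> jaco_arc h i}"
    by (simp add: in_degree_def card_image inj_on_def)
  then show ?thesis
    by (simp add: Jaco_inf_def jaco_arc.simps[of i j])
qed

definition curling_number :: "'a list \<Rightarrow> nat" where
  "curling_number S = Max {k. \<exists>X Y. Y \<noteq> [] \<and> S = X @ concat (replicate k Y)}"

lemma curling_number_set:
  assumes "S \<noteq> []"
  shows "finite {k. \<exists>X Y. Y \<noteq> [] \<and> S = X @ concat (replicate k Y)}"
    and "1 \<in> {k. \<exists>X Y. Y \<noteq> [] \<and> S = X @ concat (replicate k Y)}"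
proof -
  have "k \<le> length S" if "Y \<noteq> []" "S = X @ concat (replicate k Y)" for k X Y
  proof -
    have "length (concat (replicate k Y)) = k * length Y"
      by (induction k) auto
    moreover have "k \<le> k * length Y" using that by (cases Y) auto
    ultimately show ?thesis using that(2) by (metis length_append trans_le_add2)
  qed
  then have "{k. \<exists>X Y. Y \<noteq> [] \<and> S = X @ concat (replicate k Y)} \<subseteq> {..length S}"
    by auto
  then show "finite {k. \<exists>X Y. Y \<noteq> [] \<and> S = X @ concat (replicate k Y)}"
    using finite_subset by blast
  show "1 \<in> {k. \<exists>X Y. Y \<noteq> [] \<and> S = X @ concat (replicate k Y)}"
    using assms by (auto intro: exI[of _ "[]"])
qed

text \<open>
  For a simple graph, given as a symmetric digraph, the degree of a vertex is its out-degree.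
  The degree sequence matters only up to re-arrangement and is kept as a multiset.
\<close>
definition degree_sequence :: "('a, 'b) pre_digraph \<Rightarrow> nat multiset" where
  "degree_sequence G = image_mset (out_degree G) (mset_set (verts G))"

definition graph_curling_number :: "('a, 'b) pre_digraph \<Rightarrow> nat" where
  "graph_curling_number G =
     Max (curling_number ` permutations_of_multiset (degree_sequence G))"

end

theory Submission
  imports Defs
begin

text \<open>
  Every entry of the block \<open>Y\<close> in \<open>S = X \<circ> Y\<^sup>k\<close> occurs at least \<open>k\<close> times in \<open>S\<close>, so the curling
  number of a graph is at most the largest number of vertices that share a degree
  (\<open>curling_number_le_count\<close>). It therefore suffices that no degree occurs more than three times
  in the finite Jaco graph.

  Let \<open>a(i) = i - d\<^sup>-(v\<^sub>i)\<close> be the out-degree of \<open>v\<^sub>i\<close> in the infinite graph, so that the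
  out-neighbours of \<open>v\<^sub>i\<close> are \<open>v\<^sub>i\<^sub>+\<^sub>1, \<dots>, v\<^sub>i\<^sub>+\<^sub>a\<^sub>(\<^sub>i\<^sub>)\<close>. If all of these survive in the graph on
  \<open>n\<close> vertices, then \<open>v\<^sub>i\<close> has degree \<open>d\<^sup>-(v\<^sub>i) + a(i) = i\<close>, and such vertices have distinct
  degrees. Otherwise \<open>v\<^sub>i\<close> is adjacent to all later vertices and has degree
  \<open>d\<^sup>-(v\<^sub>i) + (n - i) = n - a(i)\<close>. So three is the bound \<open>1 + 2\<close>, provided that \<open>a\<close> takes no value
  more than twice (\<open>card_jaco_out_eq_le_2\<close>).

  For the latter, counting the vertices before \<open>v\<^sub>m\<close> that have no arc to it gives
  \<open>a(m) = 1 + |{h \<ge> 1. h + a(h) < m}|\<close>. Hence \<open>a\<close> is nondecreasing, the map \<open>h \<mapsto> h + a(h)\<close> is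
  strictly increasing, and therefore \<open>a\<close> grows by at most one per step. Then \<open>h \<mapsto> h + a(h)\<close> grows
  by at most two per step, so among \<open>m, m + 1\<close> it takes some value, and \<open>a(m + 2) > a(m)\<close>.
\<close>

section \<open>Curling numbers and multiplicities\<close>

lemma curling_number_ge_1:
  assumes "S \<noteq> []"
  shows "1 \<le> curling_number S"
  unfolding curling_number_def using curling_number_set[OF assms] by (intro Max_ge)

lemma curling_number_le_count:
  assumes "S \<noteq> []" and count: "\<And>x. count (mset S) x \<le> N"
  shows "curling_number S \<le> N"
  unfolding curling_number_def
proof (rule Max.boundedI)
  show "finite {k. \<exists>X Y. Y \<noteq> [] \<and> S = X @ concat (replicate k Y)}"
    by (rule curling_number_set[OF \<open>S \<noteq> []\<close>])
  show "{k. \<exists>X Y. Y \<noteq> [] \<and> S = X @ concat (replicate k Y)} \<noteq> {}"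
    using curling_number_set(2)[OF \<open>S \<noteq> []\<close>] by blast
  show "k \<le> N" if k: "k \<in> {k. \<exists>X Y. Y \<noteq> [] \<and> S = X @ concat (replicate k Y)}" for k
  proof -
    obtain X Y where "Y \<noteq> []" and S: "S = X @ concat (replicate k Y)" using k by blast
    have rep: "count (mset (concat (replicate k Y))) (hd Y) = k * count (mset Y) (hd Y)"
      by (induction k) auto
    have "1 \<le> count (mset Y) (hd Y)"
      using \<open>Y \<noteq> []\<close> by (simp add: Suc_le_eq count_greater_zero_iff)
    then have "k \<le> k * count (mset Y) (hd Y)" by simp
    also have "\<dots> \<le> count (mset S) (hd Y)" using rep by (simp add: S)
    also have "\<dots> \<le> N" by (rule count)
    finally show "k \<le> N" .
  qed
qed

lemma graph_curling_number_bounds: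
  assumes "degree_sequence G \<noteq> {#}" and "\<And>x. count (degree_sequence G) x \<le> N"
  shows "1 \<le> graph_curling_number G" and "graph_curling_number G \<le> N"
proof -
  have perm: "1 \<le> curling_number S \<and> curling_number S \<le> N"
    if "S \<in> permutations_of_multiset (degree_sequence G)" for S
  proof -
    have "mset S = degree_sequence G" using that by (rule permutations_of_multisetD)
    then have "S \<noteq> []" "\<And>x. count (mset S) x \<le> N" using assms by auto
    then show ?thesis using curling_number_ge_1 curling_number_le_count by blast
  qed
  have "graph_curling_number G \<in> curling_number ` permutations_of_multiset (degree_sequence G)"
    unfolding graph_curling_number_def by (rule Max_in) auto
  then show "1 \<le> graph_curling_number G" and "graph_curling_number G \<le> N"
    using perm by (metis imageE)+
qed

section \<open>Out-degrees in the infinite Jaco graph\<close>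

definition jaco_in :: "nat \<Rightarrow> nat" where
  "jaco_in i = card {h. h < i \<and> jaco_arc h i}"

definition jaco_out :: "nat \<Rightarrow> nat" where
  "jaco_out i = i - jaco_in i"

lemma jaco_in_less: "1 \<le> i \<Longrightarrow> jaco_in i < i"
proof -
  assume "1 \<le> i"
  have "{h. h < i \<and> jaco_arc h i} \<subseteq> {1..<i}"
    by (auto simp: jaco_arc.simps[of _ i])
  then have "jaco_in i \<le> card {1..<i}"
    unfolding jaco_in_def by (intro card_mono) auto
  then show ?thesis using \<open>1 \<le> i\<close> by simp
qed

lemma jaco_in_plus_out: "1 \<le> i \<Longrightarrow> jaco_in i + jaco_out i = i"
  using jaco_in_less[of i] by (simp add: jaco_out_def)

lemma jaco_arc_iff: "jaco_arc i j \<longleftrightarrow> 1 \<le> i \<and> i < j \<and> j \<le> i + jaco_out i"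
  using jaco_in_plus_out[of i]
  by (auto simp: jaco_arc.simps[of i j] jaco_in_def[symmetric])

definition jaco_before :: "nat \<Rightarrow> nat set" where
  "jaco_before m = {h. 1 \<le> h \<and> h + jaco_out h < m}"

lemma finite_jaco_before [simp]: "finite (jaco_before m)"
  by (rule finite_subset[of _ "{..<m}"]) (auto simp: jaco_before_def)

text \<open>
  Apart from \<open>v\<^sub>m\<close> itself, the vertices that \<open>m - d\<^sup>-(v\<^sub>m)\<close> counts are those before \<open>v\<^sub>m\<close> without an
  arc to \<open>v\<^sub>m\<close>, and these are the ones whose last out-neighbour comes before \<open>v\<^sub>m\<close>.
\<close>
lemma jaco_out_eq_card:
  assumes "1 \<le> m"
  shows "jaco_out m = 1 + card (jaco_before m)"
proof -
  have "{1..<m} = {h. h < m \<and> jaco_arc h m} \<union> jaco_before m"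
    by (auto simp: jaco_arc_iff jaco_before_def)
  moreover have "{h. h < m \<and> jaco_arc h m} \<inter> jaco_before m = {}"
    by (auto simp: jaco_arc_iff jaco_before_def)
  ultimately have "card {1..<m} = jaco_in m + card (jaco_before m)"
    unfolding jaco_in_def by (simp add: card_Un_disjoint)
  then show ?thesis using jaco_in_plus_out[OF assms] assms by simp
qed

lemma jaco_out_mono:
  assumes "1 \<le> i" and "i \<le> j"
  shows "jaco_out i \<le> jaco_out j"
proof -
  have "jaco_before i \<subseteq> jaco_before j" using \<open>i \<le> j\<close> by (auto simp: jaco_before_def)
  then show ?thesis using assms by (simp add: jaco_out_eq_card card_mono)
qed

text \<open>At most one \<open>h\<close> has \<open>h + a(h) = m\<close>, because \<open>h \<mapsto> h + a(h)\<close> is strictly increasing.\<close>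
lemma jaco_out_Suc_le:
  assumes "1 \<le> m"
  shows "jaco_out (Suc m) \<le> jaco_out m + 1"
proof -
  let ?E = "{h. 1 \<le> h \<and> h + jaco_out h = m}"
  have eq: "x = y" if "x \<in> ?E" "y \<in> ?E" for x y
    using that jaco_out_mono[of x y] jaco_out_mono[of y x] by (cases x y rule: linorder_cases) auto
  have "finite ?E" by (rule finite_subset[of _ "{..m}"]) auto
  then have "card ?E \<le> 1"
    using eq card_le_Suc0_iff_eq[of ?E] by (metis One_nat_def)
  moreover have "jaco_before (Suc m) = jaco_before m \<union> ?E"
    by (auto simp: jaco_before_def)
  ultimately have "card (jaco_before (Suc m)) \<le> card (jaco_before m) + 1"
    using card_Un_le[of "jaco_before m" ?E] by simp
  then show ?thesis using assms by (simp add: jaco_out_eq_card)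
qed

text \<open>
  Let \<open>h\<close> be the last index with \<open>h + a(h) < m\<close>. The next value of \<open>h \<mapsto> h + a(h)\<close> is larger by at
  most two, hence still below \<open>m + 2\<close>, and \<open>h + 1\<close> is newly counted by \<open>a(m + 2)\<close>.
  If there is no such \<open>h\<close>, then \<open>1\<close> is newly counted, since \<open>1 + a(1) = 2\<close>.
\<close>
lemma jaco_out_less_add_2:
  assumes "1 \<le> m"
  shows "jaco_out m < jaco_out (m + 2)"
proof -
  obtain h where h: "h \<in> jaco_before (m + 2)" "h \<notin> jaco_before m"
  proof (cases "jaco_before m = {}")
    case True
    have "jaco_out 1 = 1" using jaco_in_less[of 1] by (simp add: jaco_out_def)
    then have "1 \<in> jaco_before (m + 2)" using assms by (simp add: jaco_before_def)
    then show ?thesis using that True by blast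
  next
    case False
    let ?k = "Max (jaco_before m)"
    have k: "1 \<le> ?k" "?k + jaco_out ?k < m"
      using Max_in[OF finite_jaco_before False] by (simp_all add: jaco_before_def)
    then have "Suc ?k \<in> jaco_before (m + 2)"
      using jaco_out_Suc_le[of ?k] by (simp add: jaco_before_def)
    moreover have "Suc ?k \<notin> jaco_before m"
      using Max_ge[OF finite_jaco_before, of "Suc ?k" m] not_less_eq_eq by blast
    ultimately show ?thesis using that by blast
  qed
  then have "jaco_before m \<subset> jaco_before (m + 2)" by (auto simp: jaco_before_def)
  then have "card (jaco_before m) < card (jaco_before (m + 2))"
    by (rule psubset_card_mono[OF finite_jaco_before])
  then show ?thesis using assms by (simp add: jaco_out_eq_card)
qed

lemma card_jaco_out_eq_le_2:
  fixes c :: nat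
  defines "A \<equiv> {i. 1 \<le> i \<and> jaco_out i = c}"
  shows "finite A" and "card A \<le> 2"
proof -
  obtain m where sub: "A \<subseteq> {m, Suc m}"
  proof (cases "A = {}")
    case False
    define m where "m = (LEAST i. i \<in> A)"
    have m: "m \<in> A" using False unfolding m_def by (metis LeastI ex_in_conv)
    have "i \<in> {m, Suc m}" if "i \<in> A" for i
    proof -
      have "m \<le> i" unfolding m_def using that by (rule Least_le)
      moreover have "\<not> m + 2 \<le> i"
        using jaco_out_less_add_2[of m] jaco_out_mono[of "m + 2" i] m that by (auto simp: A_def)
      ultimately show ?thesis by auto
    qed
    then show ?thesis using that by blast
  qed (use that in blast)
  then show "finite A" by (rule finite_subset) simp
  have "card A \<le> card {m, Suc m}" using sub by (intro card_mono) auto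
  then show "card A \<le> 2" by simp
qed

section \<open>Degrees in the finite Jaco graph\<close>

lemma verts_Jaco_star: "verts (with_proj (Jaco_star n)) = {1..n}"
  by (auto simp: Jaco_star_def Jaco_def Jaco_inf_def mk_symmetric_def)

lemma arcs_Jaco_star:
  "arcs (with_proj (Jaco_star n)) =
     {(i, j). i \<in> {1..n} \<and> j \<in> {1..n} \<and> (jaco_arc i j \<or> jaco_arc j i)}"
  by (auto simp: Jaco_star_def Jaco_def Jaco_inf_def mk_symmetric_def)

lemma out_degree_Jaco_star:
  assumes "i \<in> {1..n}"
  shows "out_degree (with_proj (Jaco_star n)) i =
     (if i + jaco_out i \<le> n then i else n - jaco_out i)"
proof -
  let ?I = "{h. h < i \<and> jaco_arc h i}" and ?O = "{i<..min n (i + jaco_out i)}"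
  have "out_arcs (with_proj (Jaco_star n)) i = Pair i ` (?I \<union> ?O)"
    using assms unfolding out_arcs_def arcs_Jaco_star by (auto simp: jaco_arc_iff)
  then have "out_degree (with_proj (Jaco_star n)) i = card (?I \<union> ?O)"
    by (simp add: out_degree_def card_image inj_on_def)
  also have "\<dots> = jaco_in i + card ?O"
    unfolding jaco_in_def by (rule card_Un_disjoint) auto
  finally show ?thesis
    using jaco_in_plus_out[of i] assms by (auto simp: min_def)
qed

text \<open>
  At most one of the vertices with the given degree keeps all of its out-neighbours. For the
  others the degree determines \<open>a(i)\<close>, which leaves at most two of them.
\<close>
lemma count_degree_sequence_Jaco_star:
  "count (degree_sequence (with_proj (Jaco_star n))) x \<le> 3"
proof -
  let ?G = "with_proj (Jaco_star n)"
  let ?B = "{i. 1 \<le> i \<and> jaco_out i = n - x}"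
  have sub: "{i \<in> {1..n}. x = out_degree ?G i} \<subseteq> insert x ?B"
  proof
    fix i assume "i \<in> {i \<in> {1..n}. x = out_degree ?G i}"
    then have i: "i \<in> {1..n}" "x = (if i + jaco_out i \<le> n then i else n - jaco_out i)"
      using out_degree_Jaco_star[of i n] by auto
    have "jaco_out i \<le> n" using i(1) jaco_in_plus_out[of i] by auto
    then show "i \<in> insert x ?B" using i by (auto split: if_splits)
  qed
  have "count (degree_sequence ?G) x = card {i \<in> {1..n}. x = out_degree ?G i}"
    unfolding degree_sequence_def verts_Jaco_star
    by (simp add: count_image_mset')
  also have "\<dots> \<le> card (insert x ?B)"
    using sub card_jaco_out_eq_le_2(1) by (intro card_mono) auto
  also have "\<dots> \<le> Suc (card ?B)" by (rule card_insert_le_m1) auto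
  also have "\<dots> \<le> 3" using card_jaco_out_eq_le_2(2)[of "n - x"] by simp
  finally show ?thesis .
qed

theorem corollary3p4:
  fixes n :: nat
  assumes "n \<ge> 1"
  shows "1 \<le> graph_curling_number (with_proj (Jaco_star n)) \<and>
         graph_curling_number (with_proj (Jaco_star n)) \<le> 3"
proof -
  have "degree_sequence (with_proj (Jaco_star n)) \<noteq> {#}"
    unfolding degree_sequence_def verts_Jaco_star using assms by (simp add: mset_set_empty_iff)
  then show ?thesis
    using graph_curling_number_bounds count_degree_sequence_Jaco_star by blast
qed

end
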